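(* Let $A = e^{B}$, where $B \in M_n(\mathbb{R})$ is in real Jordan normal form. There exists a cross-section for the continuous action $\gamma \mapsto \gamma A^t$ $(t\in\mathbb{R})$ on $\widehat{\mathbb{R}^n}$ if and only if $A$ is not orthogonal.
   Context: $\widehat{\mathbb{R}^n}$ denotes $\mathbb{R}^n$ regarded as a space of row vectors, so matrices act on it by right multiplication. $A^t$ denotes the $t$-th power $A^t := e^{tB}$ (not a transpose). For $S\subset \widehat{\mathbb{R}^n}$, $SA^t=\{\gamma A^t:\gamma\in S\}$. A Borel set $S \subset \widehat{\mathbb{R}^n}$ is called a cross-section for the continuous action $\gamma \mapsto \gamma A^t$ $(t\in\mathbb{R})$ if (1) $\bigcup_{t\in\mathbb{R}} SA^t = \widehat{\mathbb{R}^n}\setminus N$ for some set $N$ of Lebesgue measure zero, and (2) $SA^{t_1}\cap SA^{t_2}=\emptyset$ whenever $t_1\neq t_2\in\mathbb{R}$. Real Jordan normal form: the matrix is block diagonal; a block corresponding to a real eigenvalue $\alpha$ has $\alpha$ on the diagonal, $1$ on the superdiagonal and $0$ elsewhere; a block corresponding to a pair of complex eigenvalues $\alpha\pm i\beta$, $\beta\neq 0$, is a block upper triangular matrix made of $2\times 2$ blocks with $D=\begin{pmatrix}\alpha&\beta\\-\beta&\alpha\end{pmatrix}$ on the block diagonal, the identity $I_2$ on the block superdiagonal, and $0$ elsewhere. *)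

theory Defs
  imports "HOL-Analysis.Analysis" "Jordan_Normal_Form.Jordan_Normal_Form"
begin

no_notation Matrix.vec_index (infixl "$" 100)
hide_const (open) Matrix.mat

(* The library's exp needs a normed algebra under ring multiplication, which the matrix
   product does not provide on this type; hence the power series is written out. *)
definition mat_exp :: "real^'n^'n \<Rightarrow> real^'n^'n" where
  "mat_exp B = (\<Sum>k. (1 / fact k) *\<^sub>R (((**) B ^^ k) (mat 1)))"

lemma mat_exp_sums: "(\<lambda>k. (1 / fact k) *\<^sub>R (((**) B ^^ k) (mat 1))) sums mat_exp B"
proof -
  define M where "M = (\<Sum>i\<in>UNIV. \<Sum>j\<in>UNIV. \<bar>B $ i $ j\<bar>)"
  define c where "c = real CARD('a) * M"
  have M: "\<bar>B $ i $ j\<bar> \<le> M" for i j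
  proof -
    have "\<bar>B $ i $ j\<bar> \<le> (\<Sum>j\<in>UNIV. \<bar>B $ i $ j\<bar>)"
      by (rule member_le_sum) auto
    also have "\<dots> \<le> M"
      unfolding M_def by (rule member_le_sum) (auto intro: sum_nonneg)
    finally show ?thesis .
  qed
  have entry: "\<bar>((**) B ^^ k) (mat 1) $ i $ j\<bar> \<le> c ^ k" for k i j
  proof (induction k arbitrary: i)
    case 0
    show ?case by (simp add: Finite_Cartesian_Product.mat_def)
  next
    case (Suc k)
    have "\<bar>((**) B ^^ Suc k) (mat 1) $ i $ j\<bar>
        \<le> (\<Sum>l\<in>UNIV. \<bar>B $ i $ l * ((**) B ^^ k) (mat 1) $ l $ j\<bar>)"
      by (simp add: matrix_matrix_mult_def sum_abs)
    also have "\<dots> \<le> (\<Sum>l\<in>(UNIV::'a set). M * c ^ k)"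
    proof (rule sum_mono)
      fix l
      show "\<bar>B $ i $ l * ((**) B ^^ k) (mat 1) $ l $ j\<bar> \<le> M * c ^ k"
        unfolding abs_mult using M[of i l] Suc.IH[of l] by (intro mult_mono) auto
    qed
    also have "\<dots> = c ^ Suc k" by (simp add: c_def)
    finally show ?case .
  qed
  have "summable (\<lambda>k. (1 / fact k) *\<^sub>R (((**) B ^^ k) (mat 1)))"
  proof (rule summable_comparison_test')
    show "summable (\<lambda>k. real CARD('a) * (real CARD('a) * (inverse (fact k) * c ^ k)))"
      by (intro summable_mult summable_exp)
    fix k :: nat
    let ?P = "((**) B ^^ k) (mat 1)"
    have "norm (?P $ i) \<le> real CARD('a) * c ^ k" for i
    proof -
      have "norm (?P $ i) \<le> (\<Sum>j\<in>UNIV. \<bar>?P $ i $ j\<bar>)"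
        by (rule norm_le_l1_cart)
      also have "\<dots> \<le> (\<Sum>j\<in>(UNIV::'a set). c ^ k)"
        by (intro sum_mono entry)
      finally show ?thesis by simp
    qed
    then have "(\<Sum>i\<in>UNIV. norm (?P $ i)) \<le> (\<Sum>i\<in>(UNIV::'a set). real CARD('a) * c ^ k)"
      by (intro sum_mono)
    moreover have "norm ?P \<le> (\<Sum>i\<in>UNIV. norm (?P $ i))"
      unfolding norm_vec_def[of ?P] by (rule L2_set_le_sum) simp
    ultimately have "norm ?P \<le> real CARD('a) * (real CARD('a) * c ^ k)"
      by simp
    then show "norm ((1 / fact k) *\<^sub>R ?P)
        \<le> real CARD('a) * (real CARD('a) * (inverse (fact k) * c ^ k))"
      by (simp add: divide_simps mult_ac)
  qed
  then show ?thesis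
    unfolding mat_exp_def by (rule summable_sums)
qed

definition paired_jordan_block :: "nat \<Rightarrow> real \<Rightarrow> real \<Rightarrow> real mat" where
  "paired_jordan_block m \<alpha> \<beta> = Matrix.mat (2 * m) (2 * m) (\<lambda>(i, j).
     if i div 2 = j div 2 then (if i = j then \<alpha> else if even i then \<beta> else - \<beta>)
     else if j = i + 2 then 1 else 0)"

definition real_jordan_blocks :: "real mat set" where
  "real_jordan_blocks =
     {jordan_block m \<alpha> | m \<alpha>. 0 < m} \<union> {paired_jordan_block m \<alpha> \<beta> | m \<alpha> \<beta>. 0 < m \<and> \<beta> \<noteq> 0}"

(* The indices of a type-indexed matrix are taken in increasing order: i is in position
   card {..<i}, counted from 0. *)
definition real_jordan_normal_form :: "real^'n::{finite,linorder}^'n::{finite,linorder} \<Rightarrow> bool" where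
  "real_jordan_normal_form B \<longleftrightarrow> (\<exists>Js. set Js \<subseteq> real_jordan_blocks \<and>
     diag_block_mat Js \<in> carrier_mat CARD('n) CARD('n) \<and>
     (\<forall>i j. B $ i $ j = diag_block_mat Js $$ (card {..<i}, card {..<j})))"

definition cross_section :: "(real \<Rightarrow> 'a \<Rightarrow> 'a) \<Rightarrow> 'a::euclidean_space set \<Rightarrow> bool" where
  "cross_section \<phi> S \<longleftrightarrow> S \<in> sets borel \<and>
     (\<exists>N\<in>null_sets lebesgue. (\<Union>t. \<phi> t ` S) = UNIV - N) \<and>
     (\<forall>t1 t2. t1 \<noteq> t2 \<longrightarrow> \<phi> t1 ` S \<inter> \<phi> t2 ` S = {})"

end

(* Orthogonal case: if S were a cross-section, the sweep P of S over times in [0,1] would have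
   conull union of integer translates, hence not be null, while its even translates are pairwise
   disjoint.  P need not be Borel, but it is analytic, so by Choquet's capacity argument it contains
   a compact set Q of positive measure.  The images of Q under the even powers of the orthogonal
   matrix A are then infinitely many disjoint sets of equal positive measure inside one ball.
   Only integer powers of A have to be orthogonal, so the Jordan form plays no role here.

   Non-orthogonal case: B is not skew-symmetric, so some Jordan block is not.  Let p be the first
   one or two coordinates of that block and q the next one or two.  If the real part alpha of the
   eigenvalue is nonzero, |p|^2 is multiplied by exp(2 alpha t) along the flow and {|p|^2 = 1} is a
   cross-section.  Otherwise |p| is constant, <p,q> grows at the constant rate |p|^2, and
   {<p,q> = 0, p <> 0} is a cross-section. *)

theory Submission
  imports Defs
begin

subsection \<open>Analytic sets and inner regularity\<close>

text \<open>Souslin sets as projections of closed subsets of a product with Baire space; countable unions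
  and intersections reduce to reindexing the Baire coordinate.\<close>

definition analytic_set :: "'a::topological_space set \<Rightarrow> bool" where
  "analytic_set P \<longleftrightarrow> (\<exists>C :: ('a \<times> (nat \<Rightarrow> nat)) set. closed C \<and> P = fst ` C)"

section \<open>Closure properties of analytic sets; Borel sets are analytic\<close>

lemma closed_imp_analytic:
  assumes "closed P" shows "analytic_set P"
  unfolding analytic_set_def
  by (rule exI[of _ "P \<times> UNIV"]) (use assms in \<open>auto intro: closed_Times\<close>)

text \<open>Pulls closed sets back along a change of Baire coordinates: the shift
  \<open>g = Suc\<close> serves unions, the rows \<open>g k = prod_encode (n, k)\<close> serve
  intersections.\<close>

lemma continuous_reindex:
  "continuous_on UNIV (\<lambda>z::'a::topological_space \<times> (nat \<Rightarrow> nat). (fst z, \<lambda>k. snd z (g k)))"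
  by (intro continuous_on_Pair continuous_on_fst continuous_on_id
      continuous_on_coordinatewise_then_product
      continuous_on_compose2[OF continuous_on_product_coordinates continuous_on_snd]) auto

text \<open>The naturals are discrete, so every \<open>A\<close> is closed, and evaluation at a
  coordinate is continuous.\<close>

lemma closed_coordinate: "closed {z::'a::topological_space \<times> (nat \<Rightarrow> nat). snd z i \<in> A}"
proof -
  have "closed ((\<lambda>z::'a \<times> (nat \<Rightarrow> nat). snd z i) -` A)"
    by (intro closed_vimage continuous_on_compose2[OF continuous_on_product_coordinates continuous_on_snd]
        continuous_on_id) (auto simp: closed_def open_discrete)
  then show ?thesis by (simp add: vimage_def)
qed

lemma analytic_UN:
  fixes P :: "nat \<Rightarrow> 'a::topological_space set"
  assumes "\<And>n. analytic_set (P n)"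
  shows "analytic_set (\<Union>n. P n)"
proof -
  obtain C :: "nat \<Rightarrow> ('a \<times> (nat \<Rightarrow> nat)) set" where
    C: "\<And>n. closed (C n)" "\<And>n. P n = fst ` C n"
    using assms unfolding analytic_set_def by metis
  \<comment> \<open>Coordinate 0 names the index of the union, and the shifted sequence is the
    witness for that member. Stating this as a condition for every n, vacuous unless n is the named
    index, makes \<open>D\<close> an intersection of closed sets.\<close>
  define D where "D = (\<Inter>n. {z::'a \<times> (nat \<Rightarrow> nat). snd z 0 \<in> - {n}} \<union>
     (\<lambda>z. (fst z, \<lambda>k. snd z (Suc k))) -` C n)"
  have "closed D" unfolding D_def
    by (intro closed_INT ballI closed_Un closed_coordinate closed_vimage C continuous_reindex)
  moreover have "(\<Union>n. P n) = fst ` D"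
  proof (intro equalityI subsetI)
    fix x assume "x \<in> (\<Union>n. P n)"
    then obtain n \<sigma> where "(x, \<sigma>) \<in> C n" by (auto simp: C)
    then have "(x, case_nat n \<sigma>) \<in> D" by (auto simp: D_def)
    then show "x \<in> fst ` D" by force
  next
    fix x assume "x \<in> fst ` D"
    then obtain \<sigma> where "(x, \<sigma>) \<in> D" by auto
    then have "(x, \<lambda>k. \<sigma> (Suc k)) \<in> C (\<sigma> 0)" by (auto simp: D_def)
    then show "x \<in> (\<Union>n. P n)" by (auto simp: C intro!: rev_image_eqI)
  qed
  ultimately show ?thesis unfolding analytic_set_def by blast
qed

lemma analytic_INT:
  fixes P :: "nat \<Rightarrow> 'a::topological_space set"
  assumes "\<And>n. analytic_set (P n)"
  shows "analytic_set (\<Inter>n. P n)"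
proof -
  obtain C :: "nat \<Rightarrow> ('a \<times> (nat \<Rightarrow> nat)) set" where
    C: "\<And>n. closed (C n)" "\<And>n. P n = fst ` C n"
    using assms unfolding analytic_set_def by metis
  \<comment> \<open>One sequence stores countably many witnesses: its n-th row under the pairing
    function is the witness for \<open>P n\<close>.\<close>
  define D where "D = (\<Inter>n. (\<lambda>z. (fst z, \<lambda>k. snd z (prod_encode (n, k)))) -` C n)"
  have "closed D" unfolding D_def
    by (intro closed_INT ballI closed_vimage C continuous_reindex)
  moreover have "(\<Inter>n. P n) = fst ` D"
  proof (intro equalityI subsetI)
    fix x assume "x \<in> (\<Inter>n. P n)"
    then have "x \<in> fst ` C n" for n by (simp add: C)
    then have "\<forall>n. \<exists>\<sigma>. (x, \<sigma>) \<in> C n" by (metis imageE prod.collapse)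
    then obtain \<sigma> where "\<And>n. (x, \<sigma> n) \<in> C n" by metis
    then have "(x, \<lambda>m. case prod_decode m of (n, k) \<Rightarrow> \<sigma> n k) \<in> D" by (auto simp: D_def)
    then show "x \<in> fst ` D" by force
  next
    fix x assume "x \<in> fst ` D"
    then obtain \<sigma> where "(x, \<sigma>) \<in> D" by auto
    then have "\<And>n. (x, \<lambda>k. \<sigma> (prod_encode (n, k))) \<in> C n" by (auto simp: D_def)
    then show "x \<in> (\<Inter>n. P n)" by (auto simp: C intro!: rev_image_eqI)
  qed
  ultimately show ?thesis unfolding analytic_set_def by blast
qed

lemma borel_imp_analytic:
  fixes S :: "'a::euclidean_space set"
  assumes "S \<in> sets borel"
  shows "analytic_set S"
proof -
  have open_analytic: "analytic_set U" if U: "open U" for U :: "'a set"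
  proof -
    obtain F :: "nat \<Rightarrow> 'a set" where "\<And>n. compact (F n)" "(\<Union>n. F n) = U"
      using open_Union_compact_subsets[OF U] by metis
    then show ?thesis using analytic_UN[of F] closed_imp_analytic compact_imp_closed by metis
  qed
  have "S \<in> sigma_sets UNIV {U. open U}"
    using assms by (simp add: borel_def)
  \<comment> \<open>Analyticity does not pass to complements in general, so the induction carries a
    set together with its complement; De Morgan then turns unions into intersections.\<close>
  then have "analytic_set S \<and> analytic_set (- S)"
  proof induction
    case (Basic U)
    then show ?case using open_analytic[of U] closed_imp_analytic[of "- U"] by (simp add: closed_def)
  next
    case Empty
    then show ?case by (auto intro: closed_imp_analytic)
  next
    case (Compl a)
    then show ?case by (simp add: Compl_eq_Diff_UNIV[symmetric])
  next
    case (Union a)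
    then show ?case using analytic_UN[of a] analytic_INT[of "\<lambda>n. - a n"] by simp
  qed
  then show ?thesis ..
qed

section \<open>Choquet capacitability: compact subsets of positive measure\<close>

lemma tendsto_fun_iff:
  fixes f :: "'c \<Rightarrow> 'a \<Rightarrow> 'b::topological_space"
  shows "(f \<longlongrightarrow> l) F \<longleftrightarrow> (\<forall>i. ((\<lambda>n. f n i) \<longlongrightarrow> l i) F)"
  using limitin_componentwise[of "\<lambda>_. euclidean" UNIV f l F]
  by (simp add: euclidean_product_topology limitin_canonical_iff)

text \<open>The set is a product of finite sets, so Tychonoff applies.\<close>

lemma compact_bounded_functions: "compact {\<sigma>::nat \<Rightarrow> nat. \<forall>i. \<sigma> i \<le> m i}"
proof -
  have "compactin (product_topology (\<lambda>_. euclidean) UNIV) (PiE UNIV (\<lambda>i. {..m i}))"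
    by (subst compactin_PiE) (auto simp: compactin_euclidean_iff intro: finite_imp_compact)
  moreover have "PiE UNIV (\<lambda>i. {..m i}) = {\<sigma>. \<forall>i. \<sigma> i \<le> m i}" by auto
  ultimately show ?thesis by (simp add: euclidean_product_topology compactin_euclidean_iff)
qed

lemma outer_measure_zero_imp_negligible:
  fixes P :: "'a::euclidean_space set"
  assumes "outer_measure_of lebesgue P = 0"
  shows "negligible P"
proof -
  obtain E where "E \<in> sets lebesgue" "P \<subseteq> E" "emeasure lebesgue E = 0"
    using outer_measure_of_attain[of P lebesgue] assms by auto
  then show ?thesis
    by (metis negligible_iff_null_sets null_setsI negligible_subset)
qed

text \<open>Compactness step of the capacity argument. Points of \<open>C\<close> projecting ever
  closer to \<open>x\<close>, with ever more coordinates bounded by \<open>m\<close>, have a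
  subsequence whose sequence parts converge too, and the limit lies in \<open>C\<close> over
  \<open>x\<close>.\<close>

lemma closure_bounded_sections_in_projection:
  fixes C :: "('a::metric_space \<times> (nat \<Rightarrow> nat)) set"
  assumes C: "closed C"
    and x: "\<And>n. x \<in> closure (fst ` {z \<in> C. \<forall>i<n. snd z i \<le> m i})"
  shows "x \<in> fst ` C"
proof -
  have "\<forall>n. \<exists>z\<in>C. (\<forall>i<n. snd z i \<le> m i) \<and> dist (fst z) x < inverse (Suc n)"
  proof
    fix n
    have "0 < inverse (real (Suc n))" by simp
    then obtain y where y: "y \<in> fst ` {z \<in> C. \<forall>i<n. snd z i \<le> m i}" "dist y x < inverse (Suc n)"
      using x[of n] unfolding closure_approachable by blast
    then show "\<exists>z\<in>C. (\<forall>i<n. snd z i \<le> m i) \<and> dist (fst z) x < inverse (Suc n)"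
      by blast
  qed
  then obtain z where "\<forall>n. z n \<in> C \<and> (\<forall>i<n. snd (z n) i \<le> m i) \<and> dist (fst (z n)) x < inverse (Suc n)"
    unfolding bex_simps Bex_def choice_iff by blast
  then have z: "\<And>n. z n \<in> C" "\<And>n i. i < n \<Longrightarrow> snd (z n) i \<le> m i"
    "\<And>n. dist (fst (z n)) x < inverse (Suc n)"
    by blast+
  \<comment> \<open>Only the first n coordinates of \<open>snd (z n)\<close> are known to be
    bounded. Truncating by \<open>m\<close> moves the whole sequence into a compact box and leaves
    those coordinates unchanged, so coordinatewise limits are unaffected.\<close>
  define \<tau> where "\<tau> n i = min (snd (z n) i) (m i)" for n i
  have \<tau>: "\<forall>n. \<tau> n \<in> {\<sigma>. \<forall>i. \<sigma> i \<le> m i}" by (simp add: \<tau>_def)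
  obtain l r where r: "strict_mono r" and l: "(\<tau> \<circ> r) \<longlonglongrightarrow> l"
    by (rule seq_compactE[OF compact_imp_seq_compact[OF compact_bounded_functions] \<tau>])
  have "(\<lambda>n. snd (z (r n)) i) \<longlonglongrightarrow> l i" for i
  proof -
    have "(\<lambda>n. \<tau> (r n) i) \<longlonglongrightarrow> l i" using l by (simp add: tendsto_fun_iff o_def)
    moreover have "\<forall>\<^sub>F n in sequentially. \<tau> (r n) i = snd (z (r n)) i"
      using eventually_gt_at_top[of i]
    proof eventually_elim
      case (elim n)
      then have "i < r n" using seq_suble[OF r, of n] by simp
      then show ?case using z(2) by (simp add: \<tau>_def)
    qed
    ultimately show ?thesis by (rule Lim_transform_eventually)
  qed
  then have "(\<lambda>n. snd (z (r n))) \<longlonglongrightarrow> l" by (simp add: tendsto_fun_iff)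
  moreover have "(\<lambda>n. fst (z n)) \<longlonglongrightarrow> x"
  proof (rule tendstoI)
    fix e :: real assume "0 < e"
    then have "\<forall>\<^sub>F n in sequentially. inverse (real (Suc n)) < e"
      by (rule order_tendstoD(2)[OF LIMSEQ_inverse_real_of_nat])
    then show "\<forall>\<^sub>F n in sequentially. dist (fst (z n)) x < e"
      by eventually_elim (use z(3) less_trans in blast)
  qed
  then have "(\<lambda>n. fst (z (r n))) \<longlonglongrightarrow> x"
    using LIMSEQ_subseq_LIMSEQ[OF _ r] by (fastforce simp: o_def)
  ultimately have "(\<lambda>n. (fst (z (r n)), snd (z (r n)))) \<longlonglongrightarrow> (x, l)"
    by (intro tendsto_Pair)
  then have "(x, l) \<in> C"
    using closed_sequentially[OF C, of "\<lambda>n. z (r n)"] z(1) by simp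
  then show ?thesis by force
qed

text \<open>Outer measure is continuous along increasing unions even of nonmeasurable sets. Hence
  the Baire coordinates can be bounded one after another while the outer measure of the projection
  stays above a fixed \<open>c\<close>. The closures of these projections shrink to a compact set of
  measure at least \<open>c\<close>.\<close>

lemma analytic_contains_compact:
  fixes P :: "'a::euclidean_space set"
  assumes "analytic_set P" and "\<not> negligible P"
  obtains Q where "compact Q" "Q \<subseteq> P" "0 < emeasure lebesgue Q"
proof -
  let ?\<mu> = "outer_measure_of (lebesgue :: 'a measure)"
  obtain C0 :: "('a \<times> (nat \<Rightarrow> nat)) set" where C0: "closed C0" "P = fst ` C0"
    using assms(1) unfolding analytic_set_def by blast
  have "\<exists>R::nat. \<not> negligible (P \<inter> cball 0 R)"
  proof (rule ccontr)
    assume "\<not> ?thesis"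
    then have "negligible (\<Union>R. P \<inter> cball 0 (real R))" by (intro negligible_Union_nat) auto
    moreover have "(\<Union>R. P \<inter> cball 0 (real R)) = P"
      using real_arch_simple by auto
    ultimately show False using assms(2) by simp
  qed
  then obtain R :: nat where R: "\<not> negligible (P \<inter> cball 0 R)" by blast
  \<comment> \<open>Cutting to a ball makes the closures below compact and of finite measure, which
    continuity from above requires.\<close>
  define C where "C = C0 \<inter> cball 0 (real R) \<times> UNIV"
  have "closed C" unfolding C_def by (intro closed_Int closed_Times C0) auto
  have fstC: "fst ` C = P \<inter> cball 0 (real R)" by (force simp: C_def C0)
  then have "0 < ?\<mu> (fst ` C)" using R outer_measure_zero_imp_negligible zero_less_iff_neq_zero by metis
  then obtain c where c: "0 < c" "c < ?\<mu> (fst ` C)" using dense by blast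
  \<comment> \<open>The clause for \<open>n = 0\<close> fixes the start, so that \<open>D n\<close>
    is \<open>C\<close> with bounds on exactly the first n coordinates.\<close>
  have "\<exists>D. \<forall>n. (c < ?\<mu> (fst ` D n) \<and> (n = 0 \<longrightarrow> D n = C)) \<and>
      (\<exists>k. D (Suc n) = D n \<inter> {z. snd z n \<le> k})"
  proof (rule dependent_nat_choice)
    show "\<exists>D. c < ?\<mu> (fst ` D) \<and> ((0::nat) = 0 \<longrightarrow> D = C)" using c by auto
  next
    fix D and n :: nat
    assume D: "c < ?\<mu> (fst ` D) \<and> (n = 0 \<longrightarrow> D = C)"
    define E where "E k = fst ` (D \<inter> {z. snd z n \<le> k})" for k
    \<comment> \<open>Each point has some value in coordinate n, so the sets \<open>E k\<close>
      exhaust the projection of \<open>D\<close>, and some \<open>k\<close> already keeps the outer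
      measure above \<open>c\<close>.\<close>
    have "incseq E" unfolding incseq_def E_def by fastforce
    then have "(SUP k. ?\<mu> (E k)) = ?\<mu> (\<Union>k. E k)"
      by (intro SUP_outer_measure_of_incseq) auto
    also have "(\<Union>k. E k) = fst ` D" unfolding E_def by blast
    finally have "c < (SUP k. ?\<mu> (E k))" using D by simp
    then obtain k where "c < ?\<mu> (E k)" by (auto simp: less_SUP_iff)
    then show "\<exists>D'. (c < ?\<mu> (fst ` D') \<and> (Suc n = 0 \<longrightarrow> D' = C)) \<and>
        (\<exists>k. D' = D \<inter> {z. snd z n \<le> k})"
      unfolding E_def by blast
  qed
  then obtain D where D: "\<And>n. c < ?\<mu> (fst ` D n)" "D 0 = C"
    "\<And>n. \<exists>k. D (Suc n) = D n \<inter> {z. snd z n \<le> k}"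
    by blast
  then obtain m where m: "\<And>n. D (Suc n) = D n \<inter> {z. snd z n \<le> m n}" by metis
  have D_eq: "D n = {z \<in> C. \<forall>i<n. snd z i \<le> m i}" for n
    by (induction n) (auto simp: D(2) m less_Suc_eq)
  define F where "F n = closure (fst ` D n)" for n
  have F_sub: "F n \<subseteq> cball 0 (real R)" for n
    unfolding F_def by (rule closure_minimal) (auto simp: D_eq C_def)
  have cF: "compact (F n)" for n
    using F_sub[of n] bounded_subset[OF bounded_cball] unfolding compact_eq_bounded_closed F_def by blast
  then have meas: "F n \<in> lmeasurable" for n by (rule lmeasurable_compact)
  have "(INF n. emeasure lebesgue (F n)) = emeasure lebesgue (\<Inter>n. F n)"
  proof (rule INF_emeasure_decseq)
    show "range F \<subseteq> sets lebesgue" using meas by (auto intro: fmeasurableD)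
    show "decseq F" unfolding decseq_def F_def by (auto intro!: closure_mono image_mono simp: D_eq)
    show "emeasure lebesgue (F n) \<noteq> \<infinity>" for n using fmeasurableD2[OF meas[of n]] by simp
  qed
  moreover have "c \<le> emeasure lebesgue (F n)" for n
  proof -
    have "?\<mu> (fst ` D n) \<le> ?\<mu> (F n)" unfolding F_def by (intro outer_measure_of_mono closure_subset)
    also have "?\<mu> (F n) = emeasure lebesgue (F n)" using meas by (intro outer_measure_of_eq fmeasurableD)
    finally show ?thesis using D(1)[of n] by (meson less_le_trans less_imp_le)
  qed
  ultimately have "c \<le> emeasure lebesgue (\<Inter>n. F n)" by (metis INF_greatest)
  then have "0 < emeasure lebesgue (\<Inter>n. F n)" using c(1) by order
  moreover have "(\<Inter>n. F n) \<subseteq> P"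
  proof
    fix x assume "x \<in> (\<Inter>n. F n)"
    then have "x \<in> fst ` C"
      by (intro closure_bounded_sections_in_projection[OF \<open>closed C\<close>, of x m]) (auto simp: F_def D_eq)
    then show "x \<in> P" using fstC by auto
  qed
  moreover have "compact (\<Inter>n. F n)" using cF by (intro compact_Inter) auto
  ultimately show thesis using that by blast
qed

text \<open>Projecting along a compact factor preserves closedness: parameters of a convergent
  sequence have a subsequence converging in \<open>K\<close>. The Baire witness for membership in
  \<open>S\<close> can therefore be kept while the parameter is eliminated.\<close>

lemma analytic_sweep:
  fixes f :: "'b::metric_space \<Rightarrow> 'a::metric_space \<Rightarrow> 'c::metric_space"
  assumes K: "compact K" and f: "continuous_on UNIV (\<lambda>(a, y). f a y)" and S: "analytic_set S"
  shows "analytic_set {y. \<exists>a\<in>K. f a y \<in> S}"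
proof -
  obtain C :: "('c \<times> (nat \<Rightarrow> nat)) set" where C: "closed C" "S = fst ` C"
    using S unfolding analytic_set_def by blast
  define D where "D = {p :: 'a \<times> (nat \<Rightarrow> nat). \<exists>a\<in>K. (f a (fst p), snd p) \<in> C}"
  have "closed D"
    unfolding closed_sequential_limits
  proof (intro allI impI)
    fix p l assume "(\<forall>n. p n \<in> D) \<and> p \<longlonglongrightarrow> l"
    then have p: "\<And>n. p n \<in> D" "p \<longlonglongrightarrow> l" by blast+
    have "\<forall>n. \<exists>a. a \<in> K \<and> (f a (fst (p n)), snd (p n)) \<in> C"
      using p(1) unfolding D_def by blast
    then obtain a where a: "\<forall>n. a n \<in> K" "\<And>n. (f (a n) (fst (p n)), snd (p n)) \<in> C"
      unfolding choice_iff by blast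
    obtain b r where b: "b \<in> K" and r: "strict_mono r" and lim: "(a \<circ> r) \<longlonglongrightarrow> b"
      by (rule seq_compactE[OF compact_imp_seq_compact[OF K] a(1)])
    have pr: "(\<lambda>n. p (r n)) \<longlonglongrightarrow> l"
      using LIMSEQ_subseq_LIMSEQ[OF p(2) r] by (simp add: o_def)
    then have "(\<lambda>n. (a (r n), fst (p (r n)))) \<longlonglongrightarrow> (b, fst l)"
      using lim by (intro tendsto_Pair tendsto_fst) (simp_all add: o_def)
    then have "(\<lambda>n. f (a (r n)) (fst (p (r n)))) \<longlonglongrightarrow> f b (fst l)"
      using continuous_on_tendsto_compose[OF f] by fastforce
    then have "(\<lambda>n. (f (a (r n)) (fst (p (r n))), snd (p (r n)))) \<longlonglongrightarrow> (f b (fst l), snd l)"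
      by (intro tendsto_Pair tendsto_snd pr)
    then have "(f b (fst l), snd l) \<in> C"
      by (rule closed_sequentially[OF C(1), rotated]) (rule a(2))
    then show "l \<in> D" using b unfolding D_def by blast
  qed
  moreover have "{y. \<exists>a\<in>K. f a y \<in> S} = fst ` D"
    unfolding D_def C(2) by (force simp: image_iff)
  ultimately show ?thesis unfolding analytic_set_def by blast
qed

subsection \<open>Invariance of Lebesgue measure under orthogonal maps\<close>

lemma emeasure_lebesgue_ball_eq:
  fixes a b :: "'a::euclidean_space"
  assumes "0 \<le> r"
  shows "emeasure lebesgue (ball a r) = emeasure lebesgue (ball b r)"
  using assms by (simp add: emeasure_eq_measure2 content_ball_conv_unit_ball[of r a] content_ball_conv_unit_ball[of r b])

text \<open>The library's measure-preservation lemmas for linear maps need the index type to be in class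
  wellorder. Balls are mapped to balls, so Vitali's covering theorem gives a class-free proof.\<close>

lemma orthogonal_transformation_emeasure_le:
  fixes T :: "'a::euclidean_space \<Rightarrow> 'a"
  assumes T: "orthogonal_transformation T" and U: "open U"
  shows "emeasure lebesgue (T ` U) \<le> emeasure lebesgue U"
proof -
  let ?K = "{(x, r). 0 < r \<and> ball x r \<subseteq> U}"
  have linT: "linear T" and injT: "inj T"
    using T by (auto simp: orthogonal_transformation_linear orthogonal_transformation_inj)
  obtain D where D: "countable D" "D \<subseteq> ?K"
    "pairwise (\<lambda>i j. disjnt (ball (fst i) (snd i)) (ball (fst j) (snd j))) D"
    and neg: "negligible (U - (\<Union>i\<in>D. ball (fst i) (snd i)))"
  proof (rule Vitali_covering_theorem_balls[of U ?K fst snd])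
    fix x and d :: real assume "x \<in> U" "0 < d"
    then obtain e where "0 < e" "ball x e \<subseteq> U" using U open_contains_ball by blast
    then show "\<exists>i. i \<in> ?K \<and> x \<in> ball (fst i) (snd i) \<and> snd i < d"
      \<comment> \<open>The bound \<open>e\<close> keeps the ball inside \<open>U\<close>; halving
        \<open>d\<close> gives the strict inequality on the radius.\<close>
      using \<open>0 < d\<close> by (intro exI[of _ "(x, min e (d/2))"]) (auto simp: min_def)
  qed blast
  let ?V = "\<Union>i\<in>D. ball (fst i) (snd i)"
  have disj: "disjoint_family_on (\<lambda>i. ball (fst i) (snd i)) D"
    using D(3) by (auto simp: disjoint_family_on_def pairwise_def disjnt_def)
  have img: "T ` ball x r = ball (T x) r" for x r
    using image_orthogonal_transformation_ball[OF T] .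
  have "disjoint_family_on (\<lambda>i. T ` ball (fst i) (snd i)) D"
    using disj unfolding disjoint_family_on_def by (simp add: image_Int[OF injT, symmetric])
  then have disjT: "disjoint_family_on (\<lambda>i. ball (T (fst i)) (snd i)) D"
    by (simp add: img)
  have sub: "T ` U \<subseteq> T ` ?V \<union> T ` (U - ?V)" by auto
  \<comment> \<open>A linear map sends null sets to null sets, so the part missed by the Vitali
    balls contributes nothing to the image.\<close>
  have negT: "negligible (T ` (U - ?V))"
    by (rule negligible_differentiable_image_negligible[OF _ neg])
      (auto intro: linear_imp_differentiable_on linT)
  have TV: "T ` ?V \<in> sets lebesgue"
  proof -
    have "T ` ?V = (\<Union>i\<in>D. ball (T (fst i)) (snd i))" by (simp add: image_UN img)
    moreover have "\<dots> \<in> sets borel" by (intro borel_open open_UN ballI open_ball)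
    ultimately show ?thesis by (simp add: sets_completionI_sets)
  qed
  have "emeasure lebesgue (T ` U) \<le> emeasure lebesgue (T ` ?V \<union> T ` (U - ?V))"
    by (rule emeasure_mono[OF sub sets.Un[OF TV negligible_imp_sets[OF negT]]])
  also have "\<dots> = emeasure lebesgue (T ` ?V)"
    by (rule emeasure_Un_null_set[OF TV]) (use negT in \<open>simp only: negligible_iff_null_sets\<close>)
  also have "\<dots> = emeasure lebesgue (\<Union>i\<in>D. ball (T (fst i)) (snd i))"
    by (simp add: image_UN img)
  also have "\<dots> = (\<integral>\<^sup>+i. emeasure lebesgue (ball (T (fst i)) (snd i)) \<partial>count_space D)"
    by (rule emeasure_UN_countable[OF _ D(1) disjT]) auto
  also have "\<dots> = (\<integral>\<^sup>+i. emeasure lebesgue (ball (fst i) (snd i)) \<partial>count_space D)"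
    using D(2) by (intro nn_integral_cong emeasure_lebesgue_ball_eq) auto
  also have "\<dots> = emeasure lebesgue ?V"
    by (rule emeasure_UN_countable[OF _ D(1) disj, symmetric]) auto
  also have "\<dots> \<le> emeasure lebesgue U"
  proof (rule emeasure_mono)
    have "ball (fst i) (snd i) \<subseteq> U" if "i \<in> D" for i
      using subsetD[OF D(2) that] by (simp add: case_prod_beta)
    then show "?V \<subseteq> U" by (rule UN_least)
  qed (use U in auto)
  finally show ?thesis .
qed

text \<open>Outer approximation by open sets carries the inequality over to compact sets. Applying
  it to the inverse map, which is again orthogonal, gives equality.\<close>

lemma orthogonal_transformation_emeasure_compact:
  fixes T :: "'a::euclidean_space \<Rightarrow> 'a"
  assumes T: "orthogonal_transformation T" and Q: "compact Q"
  shows "emeasure lebesgue (T ` Q) = emeasure lebesgue Q"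
proof -
  have le: "emeasure lebesgue (R ` K) \<le> emeasure lebesgue K"
    if R: "orthogonal_transformation R" and K: "compact K" for R :: "'a \<Rightarrow> 'a" and K
  proof (rule ennreal_le_epsilon)
    fix e :: real assume "0 < e"
    have K': "K \<in> sets lebesgue" using K by (simp add: fmeasurableD lmeasurable_compact)
    obtain U where U: "open U" "K \<subseteq> U" "U - K \<in> lmeasurable" "emeasure lebesgue (U - K) < ennreal e"
      using sets_lebesgue_outer_open[OF K' \<open>0 < e\<close>] .
    have "R ` U \<in> sets lebesgue"
      using U(1) R
      by (metis borel_open open_surjective_linear_image orthogonal_transformation_linear
          orthogonal_transformation_surj sets_completionI_sets sets_lborel)
    then have "emeasure lebesgue (R ` K) \<le> emeasure lebesgue (R ` U)"
      using U(2) by (intro emeasure_mono) auto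
    also have "\<dots> \<le> emeasure lebesgue U"
      by (rule orthogonal_transformation_emeasure_le[OF R U(1)])
    also have "\<dots> \<le> emeasure lebesgue (K \<union> (U - K))"
      using U K' by (intro emeasure_mono) (auto simp: fmeasurableD)
    also have "\<dots> \<le> emeasure lebesgue K + emeasure lebesgue (U - K)"
      using K' U(3) by (intro emeasure_subadditive) (auto simp: fmeasurableD)
    also have "\<dots> \<le> emeasure lebesgue K + ennreal e"
      using U(4) by (intro add_left_mono) simp
    finally show "emeasure lebesgue (R ` K) \<le> emeasure lebesgue K + ennreal e" .
  qed
  have "inv_into UNIV T ` T ` Q = Q"
    using orthogonal_transformation_inj[OF T] by (simp add: image_inv_f_f)
  moreover have "compact (T ` Q)"
    using Q T by (intro compact_continuous_image linear_continuous_on)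
      (auto simp: orthogonal_transformation_linear linear_linear)
  ultimately show ?thesis
    using le[OF T Q] le[of "inv_into UNIV T" "T ` Q"] orthogonal_transformation_inv[OF T] by auto
qed

text \<open>A packing argument: all images stay in one ball around 0 and have the measure of
  \<open>Q\<close>, so n times that measure is bounded independently of n.\<close>

lemma orthogonal_disjoint_images_null:
  fixes T :: "nat \<Rightarrow> 'a::euclidean_space \<Rightarrow> 'a"
  assumes T: "\<And>k. orthogonal_transformation (T k)" and Q: "compact Q"
    and disj: "\<And>j k. j \<noteq> k \<Longrightarrow> T j ` Q \<inter> T k ` Q = {}"
  shows "emeasure lebesgue Q = 0"
proof -
  obtain R where R: "\<And>x. x \<in> Q \<Longrightarrow> norm x \<le> R"
    using compact_imp_bounded[OF Q] unfolding bounded_iff by blast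
  have cT: "compact (T k ` Q)" for k
    using Q T[of k] by (intro compact_continuous_image linear_continuous_on)
      (auto simp: orthogonal_transformation_linear linear_linear)
  have mT: "measure lebesgue (T k ` Q) = measure lebesgue Q" for k
    using orthogonal_transformation_emeasure_compact[OF T Q] by (simp add: measure_def)
  have bound: "n * measure lebesgue Q \<le> measure lebesgue (cball (0::'a) R)" for n :: nat
  proof -
    have "measure lebesgue (\<Union>k\<in>{..<n}. T k ` Q) = (\<Sum>k<n. measure lebesgue (T k ` Q))"
    proof (rule measure_finite_Union)
      show "(\<lambda>k. T k ` Q) ` {..<n} \<subseteq> sets lebesgue"
        using lmeasurable_compact[OF cT] by (auto intro: fmeasurableD)
      show "disjoint_family_on (\<lambda>k. T k ` Q) {..<n}"
        using disj by (auto simp: disjoint_family_on_def)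
      show "emeasure lebesgue (T k ` Q) \<noteq> \<infinity>" for k
        using fmeasurableD2[OF lmeasurable_compact[OF cT[of k]]] by simp
    qed simp
    also have "\<dots> = n * measure lebesgue Q" by (simp add: mT)
    finally have "n * measure lebesgue Q = measure lebesgue (\<Union>k\<in>{..<n}. T k ` Q)" ..
    also have "\<dots> \<le> measure lebesgue (cball (0::'a) R)"
    proof (rule measure_mono_fmeasurable)
      show "(\<Union>k\<in>{..<n}. T k ` Q) \<subseteq> cball 0 R"
        using R T by (auto simp: orthogonal_transformation)
      show "(\<Union>k\<in>{..<n}. T k ` Q) \<in> sets lebesgue"
        using lmeasurable_compact[OF cT] by (auto intro: fmeasurableD)
    qed simp
    finally show ?thesis .
  qed
  have "measure lebesgue Q = 0"
  proof (rule ccontr)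
    assume "measure lebesgue Q \<noteq> 0"
    then have "0 < measure lebesgue Q" by (simp add: zero_less_measure_iff)
    then obtain n :: nat where "measure lebesgue (cball (0::'a) R) < n * measure lebesgue Q"
      using reals_Archimedean3 by blast
    then show False using bound[of n] by simp
  qed
  then show ?thesis
    using emeasure_eq_measure2[OF lmeasurable_compact[OF Q]] by simp
qed

subsection \<open>The flow of row vectors\<close>

abbreviation mat_pow :: "real^'n^'n \<Rightarrow> nat \<Rightarrow> real^'n^'n" where
  "mat_pow B k \<equiv> ((**) B ^^ k) (mat 1)"

lemma mat_pow_commute: "mat_pow B k ** B = B ** mat_pow B k"
  by (induction k) (simp_all add: matrix_mul_assoc[symmetric])

lemma mat_pow_scaleR: "mat_pow (t *\<^sub>R B) k = t ^ k *\<^sub>R mat_pow B k"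
  by (induction k)
    (simp_all add: Finite_Cartesian_Product.vec_eq_iff matrix_matrix_mult_def sum_distrib_left mult_ac)

text \<open>Each entry is a scalar power series in \<open>t\<close>, which opens the way to termwise
  differentiation.\<close>

lemma mat_exp_entry_sums:
  "(\<lambda>k. mat_pow B k $ i $ j / fact k * t ^ k) sums (mat_exp (t *\<^sub>R B) $ i $ j)"
proof -
  have "(\<lambda>k. ((1 / fact k) *\<^sub>R mat_pow (t *\<^sub>R B) k) $ i $ j) sums (mat_exp (t *\<^sub>R B) $ i $ j)"
    by (intro bounded_linear.sums[OF bounded_linear_vec_nth] mat_exp_sums)
  then show ?thesis by (simp add: mat_pow_scaleR mult_ac)
qed

lemma mat_exp_0: "mat_exp (0 *\<^sub>R B) = mat 1"
proof -
  have "mat_exp (0 *\<^sub>R B) $ i $ j = mat 1 $ i $ j" for i j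
    using sums_unique2[OF mat_exp_entry_sums[of B i j 0] powser_sums_zero] by simp
  then show ?thesis by (simp add: Finite_Cartesian_Product.vec_eq_iff)
qed

text \<open>Multiplying by \<open>B\<close> on either side shifts the powers by one. The common
  series yields both commutation with \<open>B\<close> and the derivative of the
  exponential.\<close>

lemma mat_exp_mult_sums:
  "(\<lambda>k. mat_pow B (Suc k) $ i $ j / fact k * t ^ k) sums ((mat_exp (t *\<^sub>R B) ** B) $ i $ j)"
  "(\<lambda>k. mat_pow B (Suc k) $ i $ j / fact k * t ^ k) sums ((B ** mat_exp (t *\<^sub>R B)) $ i $ j)"
proof -
  have "(\<lambda>k. \<Sum>l\<in>UNIV. (mat_pow B k $ i $ l / fact k * t ^ k) * B $ l $ j) sums
      (\<Sum>l\<in>UNIV. mat_exp (t *\<^sub>R B) $ i $ l * B $ l $ j)"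
    by (intro sums_sum sums_mult2 mat_exp_entry_sums)
  moreover have "(\<Sum>l\<in>UNIV. (mat_pow B k $ i $ l / fact k * t ^ k) * B $ l $ j)
      = mat_pow B (Suc k) $ i $ j / fact k * t ^ k" for k
  proof -
    have "mat_pow B (Suc k) $ i $ j = (mat_pow B k ** B) $ i $ j"
      by (simp add: mat_pow_commute)
    then show ?thesis
      by (simp add: matrix_matrix_mult_def sum_divide_distrib sum_distrib_left sum_distrib_right mult_ac)
  qed
  ultimately show "(\<lambda>k. mat_pow B (Suc k) $ i $ j / fact k * t ^ k) sums ((mat_exp (t *\<^sub>R B) ** B) $ i $ j)"
    by (simp add: matrix_matrix_mult_def)
  have "(\<lambda>k. \<Sum>l\<in>UNIV. B $ i $ l * (mat_pow B k $ l $ j / fact k * t ^ k)) sums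
      (\<Sum>l\<in>UNIV. B $ i $ l * mat_exp (t *\<^sub>R B) $ l $ j)"
    by (intro sums_sum sums_mult mat_exp_entry_sums)
  then show "(\<lambda>k. mat_pow B (Suc k) $ i $ j / fact k * t ^ k) sums ((B ** mat_exp (t *\<^sub>R B)) $ i $ j)"
    by (simp add: matrix_matrix_mult_def sum_divide_distrib sum_distrib_left sum_distrib_right mult_ac)
qed

lemma mat_exp_commute: "mat_exp (t *\<^sub>R B) ** B = B ** mat_exp (t *\<^sub>R B)"
  unfolding Finite_Cartesian_Product.vec_eq_iff using sums_unique2[OF mat_exp_mult_sums] by blast

lemma mat_exp_entry_deriv:
  "((\<lambda>t. mat_exp (t *\<^sub>R B) $ i $ j) has_field_derivative (mat_exp (t *\<^sub>R B) ** B) $ i $ j) (at t)"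
proof -
  define c where "c k = mat_pow B k $ i $ j / fact k" for k
  have "summable (\<lambda>k. c k * y ^ k)" for y
    using sums_summable[OF mat_exp_entry_sums[of B i j y]] by (simp add: c_def)
  then have "((\<lambda>t. \<Sum>k. c k * t ^ k) has_field_derivative (\<Sum>k. diffs c k * t ^ k)) (at t)"
    by (rule termdiffs_strong_converges_everywhere)
  moreover have "(\<lambda>t. \<Sum>k. c k * t ^ k) = (\<lambda>t. mat_exp (t *\<^sub>R B) $ i $ j)"
    by (rule ext) (simp only: c_def mat_exp_entry_sums[THEN sums_unique])
  \<comment> \<open>The factor k + 1 from differentiation cancels against (k + 1)!, leaving
    k!.\<close>
  moreover have "diffs c = (\<lambda>k. mat_pow B (Suc k) $ i $ j / fact k)"
    by (rule ext) (simp add: diffs_def c_def del: of_nat_Suc)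
  ultimately show ?thesis
    using sums_unique[OF mat_exp_mult_sums(1)[of B i j t]] by simp
qed

lemma mat_exp_entry_deriv_chain:
  assumes "(g has_field_derivative g') (at t within A)"
  shows "((\<lambda>t. mat_exp (g t *\<^sub>R B) $ i $ j) has_field_derivative
    (mat_exp (g t *\<^sub>R B) ** B) $ i $ j * g') (at t within A)"
  by (rule DERIV_chain2[where f = "\<lambda>t. mat_exp (t *\<^sub>R B) $ i $ j" and g = g, OF mat_exp_entry_deriv assms])

lemma matrix_mult_entry: "(X ** Y) $ i $ j = (\<Sum>l\<in>UNIV. X $ i $ l * Y $ l $ j)"
  by (simp add: matrix_matrix_mult_def)

text \<open>The left side is constant in \<open>t\<close>: the two terms of the product rule cancel
  because \<open>B\<close> commutes with its exponentials. At \<open>t = 0\<close> it is the right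
  side.\<close>

lemma mat_exp_add_minus: "mat_exp ((s + t) *\<^sub>R B) ** mat_exp ((- t) *\<^sub>R B) = mat_exp (s *\<^sub>R B)"
proof -
  let ?E = "\<lambda>t. mat_exp (t *\<^sub>R B)"
  have "(?E (s + t) ** ?E (- t)) $ i $ j = ?E s $ i $ j" for i j
  proof -
    define G where "G t = (\<Sum>l\<in>UNIV. ?E (s + t) $ i $ l * ?E (- t) $ l $ j)" for t
    have "(G has_field_derivative 0) (at t)" for t
    proof -
      have 1: "((\<lambda>t. ?E (s + t) $ i $ l) has_field_derivative (?E (s + t) ** B) $ i $ l) (at t)" for l
        using mat_exp_entry_deriv_chain[of "\<lambda>t. s + t" 1 t UNIV B i l]
        by (simp add: DERIV_const DERIV_add[OF DERIV_const DERIV_ident, simplified])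
      have 2: "((\<lambda>t. ?E (- t) $ l $ j) has_field_derivative - (?E (- t) ** B) $ l $ j) (at t)" for l
        using mat_exp_entry_deriv_chain[of "\<lambda>t. - t" "- 1" t UNIV B l j]
        by (simp add: DERIV_minus[OF DERIV_ident])
      have "(G has_field_derivative (\<Sum>l\<in>UNIV. (?E (s + t) ** B) $ i $ l * ?E (- t) $ l $ j
          + - (?E (- t) ** B) $ l $ j * ?E (s + t) $ i $ l)) (at t)"
        unfolding G_def by (intro DERIV_sum DERIV_mult 1 2)
      also have "(\<Sum>l\<in>UNIV. (?E (s + t) ** B) $ i $ l * ?E (- t) $ l $ j
          + - (?E (- t) ** B) $ l $ j * ?E (s + t) $ i $ l)
          = ((?E (s + t) ** B) ** ?E (- t)) $ i $ j - (?E (s + t) ** (?E (- t) ** B)) $ i $ j"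
        unfolding matrix_mult_entry[of "?E (s + t) ** B"] matrix_mult_entry[of "?E (s + t)" "?E (- t) ** B"]
          sum_subtractf[symmetric]
        by (rule sum.cong) (simp_all add: algebra_simps)
      also have "\<dots> = 0"
        by (simp only: mat_exp_commute[of "- t"] matrix_mul_assoc diff_self)
      finally show ?thesis .
    qed
    then have "G t = G 0" by (intro DERIV_isconst_all) auto
    moreover have "G 0 = ?E s $ i $ j"
      using mat_exp_0[of B] by (simp add: G_def Finite_Cartesian_Product.mat_def if_distrib cong: if_cong)
    ultimately show ?thesis by (simp add: G_def matrix_matrix_mult_def)
  qed
  then show ?thesis by (simp add: Finite_Cartesian_Product.vec_eq_iff)
qed

lemma mat_exp_add: "mat_exp ((s + t) *\<^sub>R B) = mat_exp (s *\<^sub>R B) ** mat_exp (t *\<^sub>R B)"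
proof -
  have "mat_exp (s *\<^sub>R B) ** mat_exp (t *\<^sub>R B)
      = mat_exp ((s + t) *\<^sub>R B) ** (mat_exp ((- t) *\<^sub>R B) ** mat_exp (t *\<^sub>R B))"
    by (simp only: matrix_mul_assoc mat_exp_add_minus)
  \<comment> \<open>The inverse law is the preceding identity with \<open>s = 0\<close> and
    \<open>t\<close> replaced by \<open>- t\<close>.\<close>
  also have "mat_exp ((- t) *\<^sub>R B) ** mat_exp (t *\<^sub>R B) = mat 1"
    using mat_exp_add_minus[of 0 "- t" B] mat_exp_0[of B] by simp
  finally show ?thesis by simp
qed

section \<open>The action on row vectors and its derivative\<close>

definition row_flow :: "real^'n^'n \<Rightarrow> real \<Rightarrow> real^'n \<Rightarrow> real^'n" where
  "row_flow B t \<gamma> = \<gamma> v* mat_exp (t *\<^sub>R B)"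

lemma row_flow_0: "row_flow B 0 \<gamma> = \<gamma>"
  using mat_exp_0[of B] by (simp add: row_flow_def)

lemma row_flow_add: "row_flow B (s + t) \<gamma> = row_flow B t (row_flow B s \<gamma>)"
  by (simp add: row_flow_def mat_exp_add vector_matrix_mul_assoc)

lemma row_flow_deriv:
  "((\<lambda>t. row_flow B t \<gamma> $ j) has_field_derivative (row_flow B t \<gamma> v* B) $ j) (at t within A)"
proof -
  have "((\<lambda>t. \<Sum>i\<in>UNIV. mat_exp (t *\<^sub>R B) $ i $ j * \<gamma> $ i) has_field_derivative
      (\<Sum>i\<in>UNIV. (mat_exp (t *\<^sub>R B) ** B) $ i $ j * \<gamma> $ i)) (at t)"
    by (intro DERIV_sum DERIV_cmult_right mat_exp_entry_deriv)
  moreover have "(\<Sum>i\<in>UNIV. (mat_exp (t *\<^sub>R B) ** B) $ i $ j * \<gamma> $ i) = (row_flow B t \<gamma> v* B) $ j"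
    unfolding row_flow_def vector_matrix_mul_assoc by (simp add: vector_matrix_mult_def mult.commute)
  ultimately show ?thesis
    by (simp add: row_flow_def vector_matrix_mult_def mult.commute has_field_derivative_at_within)
qed

lemma linear_row_flow: "linear (row_flow B t)"
  unfolding row_flow_def
  by (intro linearI) (simp_all add: vector_matrix_left_distrib scaleR_vector_matrix_assoc)

text \<open>Continuity jointly in time and point is what the sweep over a time interval
  requires.\<close>

lemma continuous_on_row_flow:
  fixes B :: "real^'n^'n"
  shows "continuous_on UNIV (\<lambda>(t, \<gamma>). row_flow B t \<gamma>)"
proof -
  have "continuous_on UNIV (\<lambda>t. mat_exp (t *\<^sub>R B) $ i $ j)" for i j
    by (intro continuous_at_imp_continuous_on ballI DERIV_isCont[OF mat_exp_entry_deriv])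
  then have c: "continuous_on UNIV (\<lambda>p::real \<times> (real^'n). mat_exp (fst p *\<^sub>R B) $ i $ j)" for i j
    by (rule continuous_on_compose2) (auto intro: continuous_intros)
  have "continuous_on UNIV (\<lambda>p::real \<times> (real^'n). \<chi> j. \<Sum>i\<in>UNIV. mat_exp (fst p *\<^sub>R B) $ i $ j * snd p $ i)"
    by (intro continuous_on_vec_lambda continuous_on_sum continuous_on_mult c) (intro continuous_intros)
  then show ?thesis
    by (simp add: case_prod_beta' row_flow_def vector_matrix_mult_def mult.commute)
qed

text \<open>Acting on rows by a matrix is acting on columns by its transpose, and transposition
  preserves orthogonality.\<close>

lemma orthogonal_matrix_row_flow:
  "orthogonal_transformation (row_flow B t) \<longleftrightarrow> orthogonal_matrix (mat_exp (t *\<^sub>R B))"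
proof -
  have eq: "row_flow B t = (*v) (transpose (mat_exp (t *\<^sub>R B)))"
    by (simp add: row_flow_def fun_eq_iff)
  show ?thesis
    unfolding orthogonal_transformation_matrix using linear_row_flow[of B t]
    by (simp add: eq orthogonal_matrix_transpose)
qed

text \<open>The squared norm along an orbit has derivative
  \<open>2 * ((x v* B) \<bullet> x)\<close>, which vanishes for skew \<open>B\<close>, so the flow
  is isometric.\<close>

lemma skew_imp_orthogonal:
  assumes "\<And>i j. B $ i $ j = - B $ j $ i"
  shows "orthogonal_matrix (mat_exp B)"
proof -
  have "norm (row_flow B t \<gamma>) = norm \<gamma>" for t \<gamma>
  proof -
    let ?x = "\<lambda>t. row_flow B t \<gamma>"
    have skew: "(y v* B) \<bullet> y = 0" for y
    proof -
      have "(y v* B) \<bullet> y = y \<bullet> (B *v y)" by (rule dot_lmul_matrix)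
      also have "B *v y = y v* transpose B" by simp
      also have "transpose B = - B" unfolding Finite_Cartesian_Product.vec_eq_iff transpose_def by (simp add: assms[symmetric])
      also have "y v* (- B) = - (y v* B)"
        using vector_scaleR_matrix_ac[of y "-1" B] by simp
      finally show ?thesis by (simp add: inner_commute)
    qed
    have "((\<lambda>t. \<Sum>i\<in>UNIV. ?x t $ i * ?x t $ i) has_field_derivative 0) (at t)" for t
    proof -
      have "((\<lambda>t. \<Sum>i\<in>UNIV. ?x t $ i * ?x t $ i) has_field_derivative
          (\<Sum>i\<in>UNIV. (?x t v* B) $ i * ?x t $ i + (?x t v* B) $ i * ?x t $ i)) (at t)"
        by (intro DERIV_sum DERIV_mult row_flow_deriv)
      moreover have "(\<Sum>i\<in>UNIV. (?x t v* B) $ i * ?x t $ i + (?x t v* B) $ i * ?x t $ i) = 0"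
        using skew[of "?x t"] by (simp add: inner_vec_def mult.commute flip: sum_distrib_left)
      ultimately show ?thesis by simp
    qed
    then have "(\<Sum>i\<in>UNIV. ?x t $ i * ?x t $ i) = (\<Sum>i\<in>UNIV. ?x 0 $ i * ?x 0 $ i)"
      by (intro DERIV_isconst_all) auto
    then show ?thesis by (simp add: norm_eq_sqrt_inner inner_vec_def row_flow_0)
  qed
  then have "orthogonal_transformation (row_flow B 1)"
    by (simp add: orthogonal_transformation linear_row_flow)
  then show ?thesis by (simp add: orthogonal_matrix_row_flow)
qed

text \<open>Applying \<open>\<phi> (- t)\<close> turns both conditions on translates of
  \<open>S\<close> into conditions on single orbits: almost every orbit meets \<open>S\<close>, and
  none returns to it.\<close>

lemma cross_sectionI:
  assumes "\<And>\<gamma>. \<phi> 0 \<gamma> = \<gamma>" and add: "\<And>s t \<gamma>. \<phi> (s + t) \<gamma> = \<phi> t (\<phi> s \<gamma>)"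
    and "S \<in> sets borel" and neg: "negligible {\<gamma>. \<forall>t. \<phi> t \<gamma> \<notin> S}"
    and inj: "\<And>\<gamma> t. \<gamma> \<in> S \<Longrightarrow> \<phi> t \<gamma> \<in> S \<Longrightarrow> t = 0"
  shows "cross_section \<phi> S"
proof -
  have inv: "\<phi> (- t) (\<phi> t \<gamma>) = \<gamma>" for t \<gamma>
    using add[of t "- t" \<gamma>] assms(1) by simp
  have "(\<Union>t. \<phi> t ` S) = UNIV - {\<gamma>. \<forall>t. \<phi> t \<gamma> \<notin> S}"
  proof (intro equalityI subsetI)
    fix \<gamma> assume "\<gamma> \<in> (\<Union>t. \<phi> t ` S)"
    then obtain t s where "s \<in> S" "\<gamma> = \<phi> t s" by auto
    then have "\<phi> (- t) \<gamma> \<in> S" using inv by simp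
    then show "\<gamma> \<in> UNIV - {\<gamma>. \<forall>t. \<phi> t \<gamma> \<notin> S}" by auto
  next
    fix \<gamma> assume "\<gamma> \<in> UNIV - {\<gamma>. \<forall>t. \<phi> t \<gamma> \<notin> S}"
    then obtain t where "\<phi> t \<gamma> \<in> S" by auto
    moreover have "\<gamma> = \<phi> (- t) (\<phi> t \<gamma>)" using inv by simp
    ultimately show "\<gamma> \<in> (\<Union>t. \<phi> t ` S)" by blast
  qed
  moreover have "\<phi> t1 ` S \<inter> \<phi> t2 ` S = {}" if "t1 \<noteq> t2" for t1 t2
  proof (rule ccontr)
    assume "\<phi> t1 ` S \<inter> \<phi> t2 ` S \<noteq> {}"
    then obtain a b where ab: "a \<in> S" "b \<in> S" "\<phi> t1 a = \<phi> t2 b" by auto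
    have "\<phi> (t1 + (- t2)) a = \<phi> (- t2) (\<phi> t1 a)" by (rule add)
    also have "\<dots> = b" using ab(3) inv by simp
    finally have "t1 + (- t2) = 0" using inj[of a] ab(1,2) by metis
    then show False using that by simp
  qed
  ultimately show ?thesis
    using assms(3) neg unfolding cross_section_def negligible_iff_null_sets by blast
qed

text \<open>The \<beta> terms cancel in the derivative of \<open>u\<close>, so \<open>u\<close>
  grows or decays exponentially and takes the value 1 exactly once on each orbit where it is
  positive. If \<open>i = j\<close>, the hypotheses force \<beta> = 0 and \<open>u\<close> is twice
  a square.\<close>

lemma sum_squares_section:
  fixes B :: "real^'n^'n"
  assumes "\<alpha> \<noteq> 0"
    and i: "\<And>\<gamma>. (\<gamma> v* B) $ i = \<alpha> * \<gamma> $ i - \<beta> * \<gamma> $ j"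
    and j: "\<And>\<gamma>. (\<gamma> v* B) $ j = \<alpha> * \<gamma> $ j + \<beta> * \<gamma> $ i"
  shows "cross_section (row_flow B) {\<gamma>. (\<gamma> $ i)\<^sup>2 + (\<gamma> $ j)\<^sup>2 = 1}"
proof -
  define u where "u \<gamma> = (\<gamma> $ i)\<^sup>2 + (\<gamma> $ j)\<^sup>2" for \<gamma> :: "real^'n"
  have u: "u (row_flow B t \<gamma>) = exp (2 * \<alpha> * t) * u \<gamma>" for t \<gamma>
  proof -
    have "((\<lambda>t. exp (- 2 * \<alpha> * t) * u (row_flow B t \<gamma>)) has_field_derivative 0) (at t)" for t
      unfolding u_def
      by (auto intro!: derivative_eq_intros row_flow_deriv simp: i j)
        (simp add: algebra_simps power2_eq_square)
    then have "exp (- 2 * \<alpha> * t) * u (row_flow B t \<gamma>) = exp (- 2 * \<alpha> * 0) * u (row_flow B 0 \<gamma>)"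
      by (intro DERIV_isconst_all) auto
    then have "exp (2 * \<alpha> * t) * (exp (- 2 * \<alpha> * t) * u (row_flow B t \<gamma>)) = exp (2 * \<alpha> * t) * u \<gamma>"
      by (simp add: row_flow_0)
    then show ?thesis by (simp add: mult.assoc[symmetric] exp_add[symmetric])
  qed
  have "cross_section (row_flow B) {\<gamma>. u \<gamma> = 1}"
  proof (rule cross_sectionI)
    show "{\<gamma>. u \<gamma> = 1} \<in> sets borel"
      unfolding u_def by (intro borel_closed closed_Collect_eq continuous_intros)
    have "\<exists>t. row_flow B t \<gamma> \<in> {\<gamma>. u \<gamma> = 1}" if "\<gamma> $ i \<noteq> 0" for \<gamma>
    proof -
      have pos: "0 < u \<gamma>" using that unfolding u_def by (simp add: add_pos_nonneg)
      \<comment> \<open>This time solves \<open>exp (2 * \<alpha> * t) * u \<gamma> = 1\<close>.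
        Vectors with \<open>\<gamma> $ i = 0\<close> fill only a null hyperplane.\<close>
      then have "u (row_flow B (- ln (u \<gamma>) / (2 * \<alpha>)) \<gamma>) = 1"
        using assms(1) by (simp add: u exp_minus)
      then show ?thesis by blast
    qed
    then show "negligible {\<gamma>. \<forall>t. row_flow B t \<gamma> \<notin> {\<gamma>. u \<gamma> = 1}}"
      by (intro negligible_subset[OF negligible_standard_hyperplane_cart[of i]]) auto
    show "t = 0" if "\<gamma> \<in> {\<gamma>. u \<gamma> = 1}" "row_flow B t \<gamma> \<in> {\<gamma>. u \<gamma> = 1}" for \<gamma> t
      using that assms(1) by (simp add: u)
  qed (simp_all add: row_flow_0 row_flow_add)
  then show ?thesis by (simp add: u_def)
qed

text \<open>The rotation terms cancel in the derivatives: \<open>u\<close> is constant and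
  \<open>v\<close> has derivative \<open>u\<close>. Where \<open>u\<close> is nonzero,
  \<open>v\<close> is thus a nonconstant affine function of time with exactly one zero, at
  \<open>- v \<gamma> / u \<gamma>\<close>.\<close>

lemma shear_section:
  fixes B :: "real^'n^'n"
  assumes i: "\<And>\<gamma>. (\<gamma> v* B) $ i = - \<beta> * \<gamma> $ j"
    and j: "\<And>\<gamma>. (\<gamma> v* B) $ j = \<beta> * \<gamma> $ i"
    and k: "\<And>\<gamma>. (\<gamma> v* B) $ k = - \<beta> * \<gamma> $ l + \<gamma> $ i"
    and l: "\<And>\<gamma>. (\<gamma> v* B) $ l = \<beta> * \<gamma> $ k + \<gamma> $ j"
  shows "cross_section (row_flow B)
    {\<gamma>. \<gamma> $ i * \<gamma> $ k + \<gamma> $ j * \<gamma> $ l = 0 \<and> (\<gamma> $ i)\<^sup>2 + (\<gamma> $ j)\<^sup>2 \<noteq> 0}"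
proof -
  define u where "u \<gamma> = (\<gamma> $ i)\<^sup>2 + (\<gamma> $ j)\<^sup>2" for \<gamma> :: "real^'n"
  define v where "v \<gamma> = \<gamma> $ i * \<gamma> $ k + \<gamma> $ j * \<gamma> $ l" for \<gamma> :: "real^'n"
  let ?S = "{\<gamma>. v \<gamma> = 0 \<and> u \<gamma> \<noteq> 0}"
  have du: "((\<lambda>t. u (row_flow B t \<gamma>)) has_field_derivative 0) (at t)" for t \<gamma>
    unfolding u_def
    by (auto intro!: derivative_eq_intros row_flow_deriv simp: i j)
  have u: "u (row_flow B t \<gamma>) = u \<gamma>" for t \<gamma>
  proof -
    have "u (row_flow B t \<gamma>) = u (row_flow B 0 \<gamma>)"
      by (intro DERIV_isconst_all allI du)
    then show ?thesis by (simp add: row_flow_0)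
  qed
  have v: "v (row_flow B t \<gamma>) = v \<gamma> + t * u \<gamma>" for t \<gamma>
  proof -
    have "((\<lambda>t. v (row_flow B t \<gamma>)) has_field_derivative u (row_flow B t \<gamma>)) (at t)" for t
      unfolding v_def u_def
      by (auto intro!: derivative_eq_intros row_flow_deriv simp: i j k l)
        (simp add: algebra_simps power2_eq_square)
    then have "((\<lambda>t. v (row_flow B t \<gamma>) - t * u \<gamma>) has_field_derivative 0) (at t)" for t
      by (auto intro!: derivative_eq_intros simp: u)
    then have "v (row_flow B t \<gamma>) - t * u \<gamma> = v (row_flow B 0 \<gamma>) - 0 * u \<gamma>"
      by (intro DERIV_isconst_all) auto
    then show ?thesis by (simp add: row_flow_0)
  qed
  have "cross_section (row_flow B) ?S"
  proof (rule cross_sectionI)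
    have "{\<gamma>. v \<gamma> = 0} \<in> sets borel" "{\<gamma>. u \<gamma> \<noteq> 0} \<in> sets borel"
      unfolding u_def v_def
      by (intro borel_closed borel_open closed_Collect_eq open_Collect_neq continuous_intros)+
    then show "?S \<in> sets borel" by (simp add: Collect_conj_eq sets.Int)
    have "\<exists>t. row_flow B t \<gamma> \<in> ?S" if "\<gamma> $ i \<noteq> 0" for \<gamma>
    proof -
      have "0 < u \<gamma>" using that unfolding u_def by (simp add: add_pos_nonneg)
      then have "row_flow B (- v \<gamma> / u \<gamma>) \<gamma> \<in> ?S" by (simp add: u v)
      then show ?thesis by blast
    qed
    then show "negligible {\<gamma>. \<forall>t. row_flow B t \<gamma> \<notin> ?S}"
      by (intro negligible_subset[OF negligible_standard_hyperplane_cart[of i]]) auto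
    show "t = 0" if "\<gamma> \<in> ?S" "row_flow B t \<gamma> \<in> ?S" for \<gamma> t
      using that by (simp add: u v)
  qed (simp_all add: row_flow_0 row_flow_add)
  then show ?thesis by (simp add: u_def v_def)
qed

subsection \<open>Columns of a real Jordan matrix\<close>

text \<open>The indices i, j (and k, l) need not be distinct: a real Jordan block is the case i = j, k = l,
  \<beta> = 0, so one treatment covers real and complex eigenvalues.\<close>

definition spiral_columns :: "'i set \<Rightarrow> ('i \<Rightarrow> 'i \<Rightarrow> real) \<Rightarrow> bool" where
  "spiral_columns I f \<longleftrightarrow> (\<exists>i\<in>I. \<exists>j\<in>I. \<exists>\<alpha> \<beta>. \<alpha> \<noteq> 0 \<and>
     (\<forall>x\<in>I. f x i = \<alpha> * of_bool (x = i) - \<beta> * of_bool (x = j) \<and>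
            f x j = \<alpha> * of_bool (x = j) + \<beta> * of_bool (x = i)))"

definition shear_columns :: "'i set \<Rightarrow> ('i \<Rightarrow> 'i \<Rightarrow> real) \<Rightarrow> bool" where
  "shear_columns I f \<longleftrightarrow> (\<exists>i\<in>I. \<exists>j\<in>I. \<exists>k\<in>I. \<exists>l\<in>I. \<exists>\<beta>.
     (\<forall>x\<in>I. f x i = - \<beta> * of_bool (x = j) \<and>
            f x j = \<beta> * of_bool (x = i) \<and>
            f x k = - \<beta> * of_bool (x = l) + of_bool (x = i) \<and>
            f x l = \<beta> * of_bool (x = k) + of_bool (x = j)))"

definition skew_on :: "'i set \<Rightarrow> ('i \<Rightarrow> 'i \<Rightarrow> real) \<Rightarrow> bool" where
  "skew_on I f \<longleftrightarrow> (\<forall>i\<in>I. \<forall>j\<in>I. f i j = - f j i)"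

text \<open>Both patterns prescribe entire columns, since the coordinates of
  \<open>\<gamma> v* B\<close> are read off columns. They survive embedding a block as soon as its
  columns vanish outside the rows of the block.\<close>

lemma columns_embed:
  assumes inj: "inj_on h J" and sub: "h ` J \<subseteq> I"
    and eq: "\<And>x y. x \<in> J \<Longrightarrow> y \<in> J \<Longrightarrow> f (h x) (h y) = g x y"
    and zero: "\<And>x y. x \<in> I - h ` J \<Longrightarrow> y \<in> J \<Longrightarrow> f x (h y) = 0"
  shows "spiral_columns J g \<Longrightarrow> spiral_columns I f"
    and "shear_columns J g \<Longrightarrow> shear_columns I f"
proof -
  have hI: "\<And>x. x \<in> J \<Longrightarrow> h x \<in> I" using sub by blast
  have split_I: "x \<in> I - h ` J \<or> (\<exists>x'\<in>J. x = h x')" if "x \<in> I" for x using that by blast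
  have heq: "h x = h y \<longleftrightarrow> x = y" if "x \<in> J" "y \<in> J" for x y
    using inj that by (meson inj_on_def)
  have hneq: "x \<noteq> h y" if "x \<in> I - h ` J" "y \<in> J" for x y using that by blast
  {
    assume "spiral_columns J g"
    then obtain i j \<alpha> \<beta> where ij: "i \<in> J" "j \<in> J" "\<alpha> \<noteq> 0"
      and g: "\<And>x. x \<in> J \<Longrightarrow> g x i = \<alpha> * of_bool (x = i) - \<beta> * of_bool (x = j)"
        "\<And>x. x \<in> J \<Longrightarrow> g x j = \<alpha> * of_bool (x = j) + \<beta> * of_bool (x = i)"
      unfolding spiral_columns_def by blast
    have "f x (h i) = \<alpha> * of_bool (x = h i) - \<beta> * of_bool (x = h j) \<and>
        f x (h j) = \<alpha> * of_bool (x = h j) + \<beta> * of_bool (x = h i)" if "x \<in> I" for x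
      using split_I[OF that] by (elim disjE bexE) (simp_all add: ij zero hneq eq heq g)
    then show "spiral_columns I f"
      unfolding spiral_columns_def using ij hI by blast
  next
    assume "shear_columns J g"
    then obtain i j k l \<beta> where ij: "i \<in> J" "j \<in> J" "k \<in> J" "l \<in> J"
      and g: "\<And>x. x \<in> J \<Longrightarrow> g x i = - \<beta> * of_bool (x = j)"
        "\<And>x. x \<in> J \<Longrightarrow> g x j = \<beta> * of_bool (x = i)"
        "\<And>x. x \<in> J \<Longrightarrow> g x k = - \<beta> * of_bool (x = l) + of_bool (x = i)"
        "\<And>x. x \<in> J \<Longrightarrow> g x l = \<beta> * of_bool (x = k) + of_bool (x = j)"
      unfolding shear_columns_def by blast
    have "f x (h i) = - \<beta> * of_bool (x = h j) \<and> f x (h j) = \<beta> * of_bool (x = h i) \<and>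
        f x (h k) = - \<beta> * of_bool (x = h l) + of_bool (x = h i) \<and>
        f x (h l) = \<beta> * of_bool (x = h k) + of_bool (x = h j)" if "x \<in> I" for x
      using split_I[OF that] by (elim disjE bexE) (simp_all add: ij zero hneq eq heq g)
    then show "shear_columns I f"
      unfolding shear_columns_def using ij hI by blast
  }
qed

section \<open>The trichotomy skew, spiral or shear for blocks, block sums and normal forms\<close>

lemma jordan_block_cases:
  fixes \<alpha> :: real
  assumes "0 < m"
  defines "f \<equiv> \<lambda>i j. jordan_block m \<alpha> $$ (i, j)"
  shows "skew_on {..<m} f \<or> spiral_columns {..<m} f \<or> shear_columns {..<m} f"
proof (cases "\<alpha> = 0")
  case False
  have "spiral_columns {..<m} f"
    unfolding spiral_columns_def
    by (rule bexI[of _ 0], rule bexI[of _ 0], rule exI[of _ \<alpha>], rule exI[of _ 0])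
      (use assms False in auto)
  then show ?thesis by simp
next
  case True
  show ?thesis
  proof (cases "m = 1")
    case True
    then have "skew_on {..<m} f" using \<open>\<alpha> = 0\<close> by (simp add: skew_on_def f_def)
    then show ?thesis by simp
  next
    case False
    \<comment> \<open>For \<alpha> = 0 column 0 vanishes and column 1 has a single 1, in row 0: the
      shear pattern with i = j = 0, k = l = 1 and \<beta> = 0.\<close>
    have "shear_columns {..<m} f"
      unfolding shear_columns_def
      by (rule bexI[of _ 0], rule bexI[of _ 0], rule bexI[of _ 1], rule bexI[of _ 1], rule exI[of _ 0])
        (use assms False True in auto)
    then show ?thesis by simp
  qed
qed

text \<open>The first two columns contain only the diagonal block, giving a spiral if \<alpha> is
  nonzero. If \<alpha> = 0, the next two add the identity above it, giving a shear; when there is no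
  next pair the block is skew.\<close>

lemma paired_jordan_block_cases:
  fixes \<alpha> \<beta> :: real
  assumes "0 < m"
  defines "f \<equiv> \<lambda>i j. paired_jordan_block m \<alpha> \<beta> $$ (i, j)"
  shows "skew_on {..<2 * m} f \<or> spiral_columns {..<2 * m} f \<or> shear_columns {..<2 * m} f"
proof -
  have f: "f i j = (if i div 2 = j div 2 then (if i = j then \<alpha> else if even i then \<beta> else - \<beta>)
     else if j = i + 2 then 1 else 0)" if "i < 2 * m" "j < 2 * m" for i j
    using that by (simp add: f_def paired_jordan_block_def)
  have half: "x div 2 = 0 \<longleftrightarrow> x = 0 \<or> x = 1" "x div 2 = 1 \<longleftrightarrow> x = 2 \<or> x = 3" for x :: nat
    by presburger+
  have f0: "f x 0 = \<alpha> * of_bool (x = 0) - \<beta> * of_bool (x = 1)" if "x < 2 * m" for x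
    using f[OF that, of 0] assms(1) half(1)[of x] by auto
  have f1: "f x 1 = \<alpha> * of_bool (x = 1) + \<beta> * of_bool (x = 0)" if "x < 2 * m" for x
    using f[OF that, of 1] assms(1) half(1)[of x] by auto
  show ?thesis
  proof (cases "\<alpha> = 0")
    case False
    have "spiral_columns {..<2 * m} f"
      unfolding spiral_columns_def
      by (rule bexI[of _ 0], rule bexI[of _ 1], rule exI[of _ \<alpha>], rule exI[of _ \<beta>])
        (use assms(1) False f0 f1 in auto)
    then show ?thesis by simp
  next
    case \<alpha>: True
    show ?thesis
    proof (cases "m = 1")
      case True
      have "{..<2 * m} = {0, 1}" using True by auto
      then have "skew_on {..<2 * m} f" using True by (simp add: skew_on_def f \<alpha>)
      then show ?thesis by simp
    next
      case False
      then have m: "3 < 2 * m" "2 < 2 * m" using assms(1) by auto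
      have f2: "f x 2 = - \<beta> * of_bool (x = 3) + of_bool (x = 0)" if "x < 2 * m" for x
        using f[OF that m(2)] \<alpha> half(2)[of x] by auto
      have f3: "f x 3 = \<beta> * of_bool (x = 2) + of_bool (x = 1)" if "x < 2 * m" for x
        using f[OF that m(1)] \<alpha> half(2)[of x] by auto
      have "shear_columns {..<2 * m} f"
        unfolding shear_columns_def
        by (rule bexI[of _ 0], rule bexI[of _ 1], rule bexI[of _ 2], rule bexI[of _ 3], rule exI[of _ \<beta>])
          (use m f0 f1 f2 f3 \<alpha> in auto)
      then show ?thesis by simp
    qed
  qed
qed

lemma real_jordan_block_cases:
  assumes "A \<in> real_jordan_blocks"
  shows "dim_row A = dim_col A"
    and "skew_on {..<dim_row A} (\<lambda>i j. A $$ (i, j)) \<or> spiral_columns {..<dim_row A} (\<lambda>i j. A $$ (i, j))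
      \<or> shear_columns {..<dim_row A} (\<lambda>i j. A $$ (i, j))"
proof -
  consider m \<alpha> where "0 < m" "A = jordan_block m \<alpha>"
    | m \<alpha> \<beta> where "0 < m" "A = paired_jordan_block m \<alpha> \<beta>"
    using assms unfolding real_jordan_blocks_def by blast
  then have "dim_row A = dim_col A \<and> (skew_on {..<dim_row A} (\<lambda>i j. A $$ (i, j))
      \<or> spiral_columns {..<dim_row A} (\<lambda>i j. A $$ (i, j)) \<or> shear_columns {..<dim_row A} (\<lambda>i j. A $$ (i, j)))"
  proof cases
    case 1
    then show ?thesis using jordan_block_cases[OF 1(1), of \<alpha>] by simp
  next
    case 2
    have "dim_row A = 2 * m" "dim_col A = 2 * m"
      using 2 by (simp_all add: paired_jordan_block_def)
    then show ?thesis using paired_jordan_block_cases[OF 2(1), of \<alpha> \<beta>] 2(2) by simp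
  qed
  then show "dim_row A = dim_col A"
    and "skew_on {..<dim_row A} (\<lambda>i j. A $$ (i, j)) \<or> spiral_columns {..<dim_row A} (\<lambda>i j. A $$ (i, j))
      \<or> shear_columns {..<dim_row A} (\<lambda>i j. A $$ (i, j))" by blast+
qed

text \<open>A spiral or shear in the head or in the tail embeds into the sum; otherwise both are
  skew, and so is their block sum.\<close>

lemma diag_block_cases:
  assumes "set Js \<subseteq> real_jordan_blocks"
  defines "D \<equiv> diag_block_mat Js"
  shows "dim_row D = dim_col D \<and> (skew_on {..<dim_row D} (\<lambda>i j. D $$ (i, j))
    \<or> spiral_columns {..<dim_row D} (\<lambda>i j. D $$ (i, j)) \<or> shear_columns {..<dim_row D} (\<lambda>i j. D $$ (i, j)))"
  unfolding D_def using assms(1)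
proof (induction Js)
  case Nil
  then show ?case by (simp add: skew_on_def)
next
  case (Cons A Js)
  let ?D = "diag_block_mat Js" and ?E = "diag_block_mat (A # Js)"
  let ?a = "dim_row A" and ?d = "dim_row ?D"
  have A: "dim_col A = ?a" using real_jordan_block_cases(1)[of A] Cons.prems by simp
  have D: "dim_col ?D = ?d" using Cons by simp
  have E: "?E = four_block_mat A (0\<^sub>m ?a ?d) (0\<^sub>m ?d ?a) ?D"
    using A D by (simp add: Let_def)
  have dim: "dim_row ?E = ?a + ?d" "dim_col ?E = ?a + ?d"
    unfolding E using A D by simp_all
  let ?A = "\<lambda>i j. A $$ (i, j)" and ?G = "\<lambda>i j. ?D $$ (i, j)"
  define f where "f i j = ?E $$ (i, j)" for i j
  have f: "f i j = (if i < ?a then if j < ?a then ?A i j else 0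
      else if j < ?a then 0 else ?G (i - ?a) (j - ?a))" if "i < ?a + ?d" "j < ?a + ?d" for i j
    unfolding f_def E using that A D by (subst index_mat_four_block) auto
  have "inj_on id {..<?a}" "id ` {..<?a} \<subseteq> {..<?a + ?d}"
    "\<And>x y. x \<in> {..<?a} \<Longrightarrow> y \<in> {..<?a} \<Longrightarrow> f (id x) (id y) = ?A x y"
    "\<And>x y. x \<in> {..<?a + ?d} - id ` {..<?a} \<Longrightarrow> y \<in> {..<?a} \<Longrightarrow> f x (id y) = 0"
    by (auto simp: f)
  note fst_block = columns_embed[of id "{..<?a}" "{..<?a + ?d}" f ?A, OF this]
  \<comment> \<open>The head occupies the first indices unchanged, whereas the tail is embedded by a
    shift of \<open>?a\<close>.\<close>
  have image: "(+) ?a ` {..<?d} = {?a..<?a + ?d}"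
    by (simp add: lessThan_atLeast0 image_add_atLeastLessThan add.commute)
  have "inj_on ((+) ?a) {..<?d}" "(+) ?a ` {..<?d} \<subseteq> {..<?a + ?d}"
    "\<And>x y. x \<in> {..<?d} \<Longrightarrow> y \<in> {..<?d} \<Longrightarrow> f (?a + x) (?a + y) = ?G x y"
    "\<And>x y. x \<in> {..<?a + ?d} - (+) ?a ` {..<?d} \<Longrightarrow> y \<in> {..<?d} \<Longrightarrow> f x (?a + y) = 0"
    unfolding image by (auto simp: f)
  note snd_block = columns_embed[of "(+) ?a" "{..<?d}" "{..<?a + ?d}" f ?G, OF this]
  have skew: "skew_on {..<?a + ?d} f" if sA: "skew_on {..<?a} ?A" and sD: "skew_on {..<?d} ?G"
  proof -
    have "f i j = - f j i" if ij: "i < ?a + ?d" "j < ?a + ?d" for i j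
    proof -
      consider "i < ?a" "j < ?a" | "\<not> i < ?a" "\<not> j < ?a" | "(i < ?a) \<noteq> (j < ?a)" by blast
      then show ?thesis
      proof cases
        case 1
        then have "?A i j = - ?A j i" using sA unfolding skew_on_def by blast
        then show ?thesis unfolding f[OF ij] f[OF ij(2,1)] using 1 by simp
      next
        case 2
        then have "i - ?a < ?d" "j - ?a < ?d" using ij by auto
        then have "?G (i - ?a) (j - ?a) = - ?G (j - ?a) (i - ?a)" using sD unfolding skew_on_def by blast
        then show ?thesis unfolding f[OF ij] f[OF ij(2,1)] using 2 by simp
      next
        case 3
        then show ?thesis unfolding f[OF ij] f[OF ij(2,1)] by auto
      qed
    qed
    then show ?thesis unfolding skew_on_def by blast
  qed
  have "skew_on {..<?a + ?d} f \<or> spiral_columns {..<?a + ?d} f \<or> shear_columns {..<?a + ?d} f"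
    using Cons real_jordan_block_cases(2)[of A] fst_block snd_block skew by auto
  then show ?case unfolding dim f_def by blast
qed

lemma real_jordan_normal_form_cases:
  fixes B :: "real^'n::{finite,linorder}^'n::{finite,linorder}"
  assumes "real_jordan_normal_form B"
  shows "skew_on UNIV (\<lambda>i j. B $ i $ j) \<or> spiral_columns UNIV (\<lambda>i j. B $ i $ j)
    \<or> shear_columns UNIV (\<lambda>i j. B $ i $ j)"
proof -
  obtain Js where Js: "set Js \<subseteq> real_jordan_blocks"
    "diag_block_mat Js \<in> carrier_mat CARD('n) CARD('n)"
    and B: "\<And>i j. B $ i $ j = diag_block_mat Js $$ (card {..<i}, card {..<j})"
    using assms unfolding real_jordan_normal_form_def by blast
  let ?D = "diag_block_mat Js"
  have dim: "dim_row ?D = CARD('n)" using Js(2) by auto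
  define r where "r i = card {..<i}" for i :: 'n
  have mono: "r i < r j" if "i < j" for i j
    unfolding r_def using that by (intro psubset_card_mono) auto
  have inj: "inj r" by (rule linorder_injI) (use mono in fastforce)
  have lt: "r i < CARD('n)" for i
    unfolding r_def by (rule psubset_card_mono) auto
  have "r ` UNIV = {..<CARD('n)}"
    by (rule card_subset_eq) (use lt card_image[OF inj] in auto)
  then have r_inv: "r (inv_into UNIV r x) = x" if "x < CARD('n)" for x
    using that by (simp add: f_inv_into_f)
  \<comment> \<open>The rank map \<open>r\<close> is a bijection onto the positions. With its
    inverse as embedding no index lies outside the image, so the vanishing condition of
    \<open>columns_embed\<close> is vacuous.\<close>
  have surj: "x \<in> inv_into UNIV r ` {..<CARD('n)}" for x
    by (rule image_eqI[of _ _ "r x"]) (use inj lt in auto)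
  have "inj_on (inv_into UNIV r) {..<CARD('n)}"
    by (rule inj_onI) (metis lessThan_iff r_inv)
  moreover have "inv_into UNIV r ` {..<CARD('n)} \<subseteq> UNIV" by simp
  moreover have "\<And>x y. x \<in> {..<CARD('n)} \<Longrightarrow> y \<in> {..<CARD('n)} \<Longrightarrow>
      B $ inv_into UNIV r x $ inv_into UNIV r y = ?D $$ (x, y)"
    unfolding B using r_inv by (simp add: r_def)
  moreover have "\<And>x y. x \<in> UNIV - inv_into UNIV r ` {..<CARD('n)} \<Longrightarrow> y \<in> {..<CARD('n)} \<Longrightarrow>
      B $ x $ inv_into UNIV r y = 0"
    using surj by blast
  ultimately have "(spiral_columns {..<CARD('n)} (\<lambda>i j. ?D $$ (i, j)) \<longrightarrow> spiral_columns UNIV (\<lambda>i j. B $ i $ j))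
    \<and> (shear_columns {..<CARD('n)} (\<lambda>i j. ?D $$ (i, j)) \<longrightarrow> shear_columns UNIV (\<lambda>i j. B $ i $ j))"
    using columns_embed[of "inv_into UNIV r" "{..<CARD('n)}" UNIV "\<lambda>i j. B $ i $ j" "\<lambda>i j. ?D $$ (i, j)"]
    by blast
  moreover have "skew_on UNIV (\<lambda>i j. B $ i $ j)" if "skew_on {..<CARD('n)} (\<lambda>i j. ?D $$ (i, j))"
    using that lt unfolding skew_on_def B r_def by blast
  ultimately show ?thesis
    using diag_block_cases[OF Js(1)] unfolding dim by blast
qed

lemma sum_of_bool_eq:
  "(\<Sum>x\<in>UNIV. y x * (c * of_bool (x = i))) = c * (y (i :: 'n::finite) :: real)"
  by (simp add: of_bool_def if_distrib cong: if_cong)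

lemma row_vector_mult_entry: "(\<gamma> v* B) $ j = (\<Sum>i\<in>UNIV. \<gamma> $ i * B $ i $ j)" for B :: "real^'n^'m"
  by (simp add: vector_matrix_mult_def mult.commute)

subsection \<open>Cross-sections\<close>

lemma orthogonal_imp_no_cross_section:
  fixes B :: "real^'n^'n"
  assumes orth: "orthogonal_matrix (mat_exp B)"
  shows "\<not> cross_section (row_flow B) S"
proof
  assume "cross_section (row_flow B) S"
  note S = this[unfolded cross_section_def]
  note borel = S[THEN conjunct1] and cover = S[THEN conjunct2, THEN conjunct1]
    and sep = S[THEN conjunct2, THEN conjunct2]
  obtain N where N: "negligible N" "(\<Union>t. row_flow B t ` S) = UNIV - N"
    using cover by (auto simp only: negligible_iff_null_sets)
  have disj: "t1 = t2" if s: "s1 \<in> S" "s2 \<in> S" "row_flow B t1 s1 = row_flow B t2 s2" for s1 s2 t1 t2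
  proof (rule ccontr)
    assume "t1 \<noteq> t2"
    then have "row_flow B t1 ` S \<inter> row_flow B t2 ` S = {}" using sep by simp
    moreover have "row_flow B t1 s1 \<in> row_flow B t1 ` S" using s(1) by (rule imageI)
    moreover have "row_flow B t1 s1 \<in> row_flow B t2 ` S" unfolding s(3) using s(2) by (rule imageI)
    ultimately show False by blast
  qed
  have inv: "row_flow B t (row_flow B (- t) y) = y" for t y
    using row_flow_add[of B "- t" t y] by (simp add: row_flow_0)
  \<comment> \<open>The sweep of \<open>S\<close> over times in [0,1], written by flowing backwards
    into \<open>S\<close> so that \<open>analytic_sweep\<close> applies.\<close>
  define P where "P = {y. \<exists>a\<in>{0..1}. row_flow B (- a) y \<in> S}"
  have "continuous_on UNIV (\<lambda>(a, y). row_flow B (- a) y)"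
  proof -
    have "continuous_on UNIV (\<lambda>p::real \<times> (real^'n). (- fst p, snd p))"
      by (intro continuous_intros)
    from continuous_on_compose2[OF continuous_on_row_flow[of B] this]
    show ?thesis by (simp add: case_prod_beta')
  qed
  then have "analytic_set P"
    unfolding P_def by (intro analytic_sweep compact_Icc borel_imp_analytic borel)
  moreover have "\<not> negligible P"
  proof
    assume P: "negligible P"
    have "UNIV \<subseteq> N \<union> (\<Union>k\<in>(UNIV::int set). row_flow B (of_int k) ` P)"
    proof
      fix y
      show "y \<in> N \<union> (\<Union>k\<in>(UNIV::int set). row_flow B (of_int k) ` P)"
      proof (cases "y \<in> N")
        case False
        then have "y \<in> (\<Union>t. row_flow B t ` S)" using N(2) by blast
        then obtain t s where s: "s \<in> S" "y = row_flow B t s" by blast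
        \<comment> \<open>Splitting \<open>t\<close> into integer and fractional part: after the
          fractional time the orbit point lies in \<open>P\<close>, and an integer translation
          carries it to \<open>y\<close>.\<close>
        have return: "row_flow B (- (t - \<lfloor>t\<rfloor>)) (row_flow B (t - \<lfloor>t\<rfloor>) s) = s"
          using inv[of "- (t - \<lfloor>t\<rfloor>)" s] by simp
        have frac: "t - \<lfloor>t\<rfloor> \<in> {0..1}" by (simp add: less_imp_le) linarith
        have "row_flow B (t - \<lfloor>t\<rfloor>) s \<in> P"
          unfolding P_def mem_Collect_eq by (rule bexI[OF _ frac]) (simp only: return s(1))
        moreover have "y = row_flow B \<lfloor>t\<rfloor> (row_flow B (t - \<lfloor>t\<rfloor>) s)"
          using row_flow_add[of B "t - \<lfloor>t\<rfloor>" "\<lfloor>t\<rfloor>" s] s(2) by simp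
        ultimately show ?thesis by blast
      qed simp
    qed
    moreover have "negligible (row_flow B (of_int k) ` P)" for k :: int
      by (rule negligible_differentiable_image_negligible[OF _ P])
        (auto intro: linear_imp_differentiable_on linear_row_flow)
    then have "negligible (N \<union> (\<Union>k\<in>(UNIV::int set). row_flow B (of_int k) ` P))"
      by (intro negligible_Un N(1) negligible_countable_Union) auto
    ultimately have "negligible (UNIV :: (real^'n) set)" by (rule negligible_subset[rotated])
    then show False by simp
  qed
  ultimately obtain Q where Q: "compact Q" "Q \<subseteq> P" "0 < emeasure lebesgue Q"
    by (rule analytic_contains_compact)
  \<comment> \<open>At natural times the exponential is a power of \<open>mat_exp B\<close>, hence
    orthogonal.\<close>
  have orth_nat: "orthogonal_matrix (mat_exp (real k *\<^sub>R B))" for k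
  proof (induction k)
    case 0
    show ?case using mat_exp_0[of B] by (simp add: orthogonal_matrix_id)
  next
    case (Suc k)
    have "mat_exp (real (Suc k) *\<^sub>R B) = mat_exp (real k *\<^sub>R B) ** mat_exp B"
      using mat_exp_add[of "real k" 1 B] by (simp add: add.commute)
    then show ?case using orthogonal_matrix_mul[OF Suc orth] by simp
  qed
  have "emeasure lebesgue Q = 0"
  proof (rule orthogonal_disjoint_images_null)
    show "orthogonal_transformation (row_flow B (real (2 * k)))" for k
      unfolding orthogonal_matrix_row_flow by (rule orth_nat)
    show "row_flow B (real (2 * j)) ` Q \<inter> row_flow B (real (2 * k)) ` Q = {}" if "j \<noteq> k" for j k
    proof (rule ccontr)
      assume "\<not> ?thesis"
      then obtain x y where xy: "x \<in> Q" "y \<in> Q"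
        "row_flow B (real (2 * j)) x = row_flow B (real (2 * k)) y" by blast
      obtain a b where ab: "a \<in> {0..1}" "row_flow B (- a) x \<in> S" "b \<in> {0..1}" "row_flow B (- b) y \<in> S"
        using xy(1,2) Q(2) unfolding P_def by blast
      \<comment> \<open>Both sides start in \<open>S\<close>, so the total times agree. But
        \<open>a\<close> and \<open>b\<close> differ by at most 1, while distinct even times differ
        by at least 2.\<close>
      have "row_flow B (a + real (2 * j)) (row_flow B (- a) x) = row_flow B (b + real (2 * k)) (row_flow B (- b) y)"
        using xy(3) by (simp only: row_flow_add inv)
      then have "a + real (2 * j) = b + real (2 * k)"
        using disj ab(2,4) by blast
      moreover have "real (2 * j) + 2 \<le> real (2 * k) \<or> real (2 * k) + 2 \<le> real (2 * j)"
        using that by linarith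
      ultimately show False using ab(1,3) by auto
    qed
  qed (rule Q(1))
  then show False using Q(3) by simp
qed

lemma row_flow_eq: "(\<lambda>t \<gamma>. \<gamma> v* mat_exp (t *\<^sub>R B)) = row_flow B"
  by (simp add: fun_eq_iff row_flow_def)

theorem theorem3:
  fixes A B :: "real^'n::{finite,linorder}^'n::{finite,linorder}"
  assumes "real_jordan_normal_form B"
    and "A = mat_exp B"
  shows "(\<exists>S. cross_section (\<lambda>t \<gamma>. \<gamma> v* mat_exp (t *\<^sub>R B)) S) \<longleftrightarrow> \<not> orthogonal_matrix A"
proof
  assume "\<exists>S. cross_section (\<lambda>t \<gamma>. \<gamma> v* mat_exp (t *\<^sub>R B)) S"
  then show "\<not> orthogonal_matrix A"
    using orthogonal_imp_no_cross_section[of B] unfolding row_flow_eq assms(2) by blast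
next
  assume A: "\<not> orthogonal_matrix A"
  have "\<not> skew_on UNIV (\<lambda>i j. B $ i $ j)"
    using A skew_imp_orthogonal[of B] unfolding assms(2) skew_on_def by blast
  then consider "spiral_columns UNIV (\<lambda>i j. B $ i $ j)" | "shear_columns UNIV (\<lambda>i j. B $ i $ j)"
    using real_jordan_normal_form_cases[OF assms(1)] by blast
  then show "\<exists>S. cross_section (\<lambda>t \<gamma>. \<gamma> v* mat_exp (t *\<^sub>R B)) S"
    unfolding row_flow_eq
  proof cases
    case 1
    then obtain i j \<alpha> \<beta> where "\<alpha> \<noteq> 0"
      and B: "\<And>x. B $ x $ i = \<alpha> * of_bool (x = i) - \<beta> * of_bool (x = j)"
        "\<And>x. B $ x $ j = \<alpha> * of_bool (x = j) + \<beta> * of_bool (x = i)"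
      unfolding spiral_columns_def by blast
    have "(\<gamma> v* B) $ i = \<alpha> * \<gamma> $ i - \<beta> * \<gamma> $ j" "(\<gamma> v* B) $ j = \<alpha> * \<gamma> $ j + \<beta> * \<gamma> $ i" for \<gamma>
      by (simp_all only: row_vector_mult_entry B distrib_left right_diff_distrib sum.distrib sum_subtractf
          sum_of_bool_eq)
    then show "\<exists>S. cross_section (row_flow B) S"
      using sum_squares_section[OF \<open>\<alpha> \<noteq> 0\<close>, of B i \<beta> j] by blast
  next
    case 2
    \<comment> \<open>The explicit factor 1 gives every summand the form expected by
      \<open>sum_of_bool_eq\<close>.\<close>
    then obtain i j k l \<beta> where B: "\<And>x. B $ x $ i = - \<beta> * of_bool (x = j)"
        "\<And>x. B $ x $ j = \<beta> * of_bool (x = i)"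
        "\<And>x. B $ x $ k = - \<beta> * of_bool (x = l) + 1 * of_bool (x = i)"
        "\<And>x. B $ x $ l = \<beta> * of_bool (x = k) + 1 * of_bool (x = j)"
      unfolding shear_columns_def mult_1 by blast
    have "(\<gamma> v* B) $ i = - \<beta> * \<gamma> $ j" "(\<gamma> v* B) $ j = \<beta> * \<gamma> $ i"
      "(\<gamma> v* B) $ k = - \<beta> * \<gamma> $ l + \<gamma> $ i" "(\<gamma> v* B) $ l = \<beta> * \<gamma> $ k + \<gamma> $ j" for \<gamma>
      by (simp_all only: row_vector_mult_entry B distrib_left sum.distrib sum_of_bool_eq
          sum_of_bool_eq[where c = 1, unfolded mult_1] mult_1)
    then show "\<exists>S. cross_section (row_flow B) S"
      using shear_section[of B i \<beta> j k l] by blast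
  qed
qed

end
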